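(* For every $n\in\mathbb{N}$ the following statements are true: 1) The quaternion algebra $\mathbb{H}_{\mathbb{Q}}\left( f_{10n+5},-1\right)$ is a split algebra over $\mathbb{Q}$. 2) The quaternion algebra $\mathbb{H}_{\mathbb{Q}}\left( \frac{1}{5}l_{20n},-\frac{2}{5}\right)$ is a split algebra over $\mathbb{Q}$. 3) The quaternion algebra $\mathbb{H}_{\mathbb{Q}}\left( f_{n+1}f_{n-1},(-1)^{n-1}\right)$ is a split algebra over $\mathbb{Q}$. 4) The quaternion algebra $\mathbb{H}_{\mathbb{Q}}\left( 5,(-1)^{n}\right)$ is a split algebra over $\mathbb{Q}$. 5) The quaternion algebra $\mathbb{H}_{\mathbb{Q}}\left( l_{2n}l_{2n+2},-5\right)$ is a split algebra over $\mathbb{Q}$. 6) The quaternion algebra $\mathbb{H}_{\mathbb{Q}}\left( 2f_{n}f_{n+1},-f_{2n}\right)$ is a split algebra over $\mathbb{Q}$. 7) The quaternion algebra $\mathbb{H}_{\mathbb{Q}}\left( f_{2n},-2f_{n}f_{n-1}\right)$ is a split algebra over $\mathbb{Q}$. 8) The quaternion algebras $\mathbb{H}_{\mathbb{Q}}\left( f_{n-1}f_{n+1},f_{n}^{2}\right)$ and $\mathbb{H}_{\mathbb{Q}}\left( 1,-f_{n-1}f_{n+1}\right)$ are split algebras over $\mathbb{Q}$. 9) The quaternion algebra $\mathbb{H}_{\mathbb{Q}}\left( f_{2n},1\right)$ is a split algebra over $\mathbb{Q}$.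
   Context: $(f_n)$ is the Fibonacci sequence: $f_0=0$, $f_1=1$, $f_n=f_{n-1}+f_{n-2}$, extended to negative indices by $f_{-n}=(-1)^{n+1}f_n$ (so $f_{-1}=1$). $(l_n)$ is the Lucas sequence: $l_0=2$, $l_1=1$, $l_n=l_{n-1}+l_{n-2}$. Here $\mathbb{N}$ includes $0$. For $a,b\in\mathbb{Q}$, $\mathbb{H}_{\mathbb{Q}}(a,b)$ is the generalized quaternion algebra over $\mathbb{Q}$ with basis $\{1,e_2,e_3,e_4\}$, unit $1$, and multiplication $e_2^2=a$, $e_3^2=b$, $e_4^2=-ab$, $e_2e_3=e_4=-e_3e_2$, $e_2e_4=ae_3=-e_4e_2$, $e_4e_3=be_2=-e_3e_4$. The norm of $x=x_1+x_2e_2+x_3e_3+x_4e_4$ is $\mathbf{n}(x)=x_1^2-ax_2^2-bx_3^2+ab\,x_4^2$. The algebra is called a division algebra if $\mathbf{n}(x)=0$ implies $x=0$; otherwise (i.e. if there is $x\neq 0$ in the algebra with $\mathbf{n}(x)=0$) it is called a split algebra. The parameters $a,b$ are allowed to be $0$ (which happens in some of the families for small $n$), and the same definition of split is used. *)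

theory Defs
  imports "HOL-Algebra.Module" "HOL-Number_Theory.Fib"
begin

definition fibz :: "int \<Rightarrow> int" where
  "fibz k = (if 0 \<le> k then int (fib (nat k))
             else (- 1) ^ (nat (- k) + 1) * int (fib (nat (- k))))"

lemma fibz_rec: "fibz k = fibz (k - 1) + fibz (k - 2)"
proof -
  consider "2 \<le> k" | "k = 1" | "k \<le> 0" by linarith
  then show ?thesis
  proof cases
    case 1
    define m where "m = nat (k - 2)"
    have "k = int m + 2" using 1 by (simp add: m_def)
    moreover have "nat (int m + 2) = Suc (Suc m)" "nat (1 + int m) = Suc m" by auto
    ultimately show ?thesis by (simp add: fibz_def)
  next
    case 2
    then show ?thesis by (simp add: fibz_def)
  next
    case 3
    define m where "m = nat (- k)"
    have k: "k = - int m" using 3 by (simp add: m_def)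
    have "nat (1 + int m) = Suc m" "nat (2 + int m) = Suc (Suc m)" by auto
    then show ?thesis unfolding k by (cases "m = 0") (auto simp: fibz_def algebra_simps)
  qed
qed

fun lucas :: "nat \<Rightarrow> nat" where
  "lucas 0 = 2"
| "lucas (Suc 0) = 1"
| "lucas (Suc (Suc n)) = lucas (Suc n) + lucas n"

text \<open>\<open>Quat x1 x2 x3 x4\<close> stands for the element x1 + x2 e2 + x3 e3 + x4 e4.\<close>

datatype quat = Quat rat rat rat rat

text \<open>The algebra depends on the parameters only through its product and its norm, so all the
  algebras share the carrier type \<open>quat\<close>.\<close>

record quat_algebra = "(rat, quat) module" +
  qnorm :: "quat \<Rightarrow> rat"

fun quat_add :: "quat \<Rightarrow> quat \<Rightarrow> quat" where
  "quat_add (Quat x1 x2 x3 x4) (Quat y1 y2 y3 y4) =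
     Quat (x1 + y1) (x2 + y2) (x3 + y3) (x4 + y4)"

fun quat_scale :: "rat \<Rightarrow> quat \<Rightarrow> quat" where
  "quat_scale c (Quat x1 x2 x3 x4) = Quat (c * x1) (c * x2) (c * x3) (c * x4)"

text \<open>The bilinear extension of the multiplication table of the basis; see \<open>quat_table\<close>.\<close>

fun quat_mult :: "rat \<Rightarrow> rat \<Rightarrow> quat \<Rightarrow> quat \<Rightarrow> quat" where
  "quat_mult a b (Quat x1 x2 x3 x4) (Quat y1 y2 y3 y4) =
     Quat (x1 * y1 + a * x2 * y2 + b * x3 * y3 - a * b * x4 * y4)
          (x1 * y2 + x2 * y1 - b * x3 * y4 + b * x4 * y3)
          (x1 * y3 + x3 * y1 + a * x2 * y4 - a * x4 * y2)
          (x1 * y4 + x4 * y1 + x2 * y3 - x3 * y2)"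

fun quat_norm :: "rat \<Rightarrow> rat \<Rightarrow> quat \<Rightarrow> rat" where
  "quat_norm a b (Quat x1 x2 x3 x4) = x1\<^sup>2 - a * x2\<^sup>2 - b * x3\<^sup>2 + a * b * x4\<^sup>2"

definition HQ :: "rat \<Rightarrow> rat \<Rightarrow> quat_algebra" where
  "HQ a b = \<lparr> carrier = UNIV, mult = quat_mult a b, one = Quat 1 0 0 0,
              zero = Quat 0 0 0 0, add = quat_add, smult = quat_scale,
              qnorm = quat_norm a b \<rparr>"

definition division_algebra :: "quat_algebra \<Rightarrow> bool" where
  "division_algebra A \<longleftrightarrow> (\<forall>x \<in> carrier A. qnorm A x = 0 \<longrightarrow> x = \<zero>\<^bsub>A\<^esub>)"

definition split_algebra :: "quat_algebra \<Rightarrow> bool" where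
  "split_algebra A \<longleftrightarrow> \<not> division_algebra A"

lemma split_algebra_iff:
  "split_algebra A \<longleftrightarrow> (\<exists>x \<in> carrier A. x \<noteq> \<zero>\<^bsub>A\<^esub> \<and> qnorm A x = 0)"
  by (auto simp: split_algebra_def division_algebra_def)

lemma quat_table:
  fixes a b :: rat
  defines "e2 \<equiv> Quat 0 1 0 0" and "e3 \<equiv> Quat 0 0 1 0" and "e4 \<equiv> Quat 0 0 0 1"
  shows "quat_mult a b e2 e2 = quat_scale a (Quat 1 0 0 0)"
    and "quat_mult a b e3 e3 = quat_scale b (Quat 1 0 0 0)"
    and "quat_mult a b e4 e4 = quat_scale (- (a * b)) (Quat 1 0 0 0)"
    and "quat_mult a b e2 e3 = e4" and "quat_mult a b e3 e2 = quat_scale (- 1) e4"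
    and "quat_mult a b e2 e4 = quat_scale a e3" and "quat_mult a b e4 e2 = quat_scale (- a) e3"
    and "quat_mult a b e4 e3 = quat_scale b e2" and "quat_mult a b e3 e4 = quat_scale (- b) e2"
  by (simp_all add: e2_def e3_def e4_def)

lemma quat_mult_scale:
  "quat_mult a b (quat_scale c x) y = quat_scale c (quat_mult a b x y)"
  "quat_mult a b x (quat_scale c y) = quat_scale c (quat_mult a b x y)"
  by (cases x; cases y; simp add: algebra_simps)+

lemma quat_norm_mult_conj:
  "quat_mult a b (Quat x1 x2 x3 x4) (Quat x1 (- x2) (- x3) (- x4)) =
     quat_scale (quat_norm a b (Quat x1 x2 x3 x4)) (Quat 1 0 0 0)"
  by (simp add: power2_eq_square algebra_simps)

lemma HQ_ring: "ring (HQ a b)"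
proof (rule ringI)
  show "abelian_group (HQ a b)"
  proof (rule abelian_groupI)
    fix x assume "x \<in> carrier (HQ a b)"
    show "\<exists>y \<in> carrier (HQ a b). y \<oplus>\<^bsub>HQ a b\<^esub> x = \<zero>\<^bsub>HQ a b\<^esub>"
      by (cases x, rule bexI[of _ "quat_scale (- 1) x"]) (auto simp: HQ_def)
  next
    fix x y z
    show "(x \<oplus>\<^bsub>HQ a b\<^esub> y) \<oplus>\<^bsub>HQ a b\<^esub> z = x \<oplus>\<^bsub>HQ a b\<^esub> (y \<oplus>\<^bsub>HQ a b\<^esub> z)"
      by (cases x; cases y; cases z) (simp add: HQ_def)
  next
    fix x y
    show "x \<oplus>\<^bsub>HQ a b\<^esub> y = y \<oplus>\<^bsub>HQ a b\<^esub> x"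
      by (cases x; cases y) (simp add: HQ_def)
  next
    fix x
    show "\<zero>\<^bsub>HQ a b\<^esub> \<oplus>\<^bsub>HQ a b\<^esub> x = x"
      by (cases x) (simp add: HQ_def)
  qed (auto simp: HQ_def)
  show "Group.monoid (HQ a b)"
  proof (rule monoidI)
    fix x y z
    show "(x \<otimes>\<^bsub>HQ a b\<^esub> y) \<otimes>\<^bsub>HQ a b\<^esub> z = x \<otimes>\<^bsub>HQ a b\<^esub> (y \<otimes>\<^bsub>HQ a b\<^esub> z)"
      by (cases x; cases y; cases z) (simp add: HQ_def algebra_simps)
  next
    fix x
    show "\<one>\<^bsub>HQ a b\<^esub> \<otimes>\<^bsub>HQ a b\<^esub> x = x" by (cases x) (simp add: HQ_def)
    show "x \<otimes>\<^bsub>HQ a b\<^esub> \<one>\<^bsub>HQ a b\<^esub> = x" by (cases x) (simp add: HQ_def)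
  qed (auto simp: HQ_def)
  fix x y z
  show "(x \<oplus>\<^bsub>HQ a b\<^esub> y) \<otimes>\<^bsub>HQ a b\<^esub> z = x \<otimes>\<^bsub>HQ a b\<^esub> z \<oplus>\<^bsub>HQ a b\<^esub> y \<otimes>\<^bsub>HQ a b\<^esub> z"
    by (cases x; cases y; cases z) (simp add: HQ_def algebra_simps)
  show "z \<otimes>\<^bsub>HQ a b\<^esub> (x \<oplus>\<^bsub>HQ a b\<^esub> y) = z \<otimes>\<^bsub>HQ a b\<^esub> x \<oplus>\<^bsub>HQ a b\<^esub> z \<otimes>\<^bsub>HQ a b\<^esub> y"
    by (cases x; cases y; cases z) (simp add: HQ_def algebra_simps)
qed

end

theory Submission
  imports Defs
begin

text \<open>The norm of \<open>x + y e2 + z e3\<close> is \<open>x\<^sup>2 - a y\<^sup>2 - b z\<^sup>2\<close>, so the algebra with parameters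
  \<open>a, b\<close> splits as soon as the conic \<open>a y\<^sup>2 + b z\<^sup>2 = x\<^sup>2\<close> has a nonzero rational point
  (\<open>split_if_conic_point\<close>); this includes the degenerate cases \<open>a = 0\<close> or \<open>b = 0\<close>. Each family
  comes with such a point, and for most of them \<open>y = z = 1\<close> works, because the sum of the two
  parameters is a square:

  \<^item> \<open>f\<^bsub>2m+1\<^esub> = f\<^bsub>m\<^esub>\<^sup>2 + f\<^bsub>m+1\<^esub>\<^sup>2\<close>, used with \<open>m = 5n + 2\<close>; here \<open>y = 1\<close>, \<open>z = f\<^bsub>m+1\<^esub>\<close>;
  \<^item> \<open>l\<^bsub>2m\<^esub> = 5 f\<^bsub>m\<^esub>\<^sup>2 + 2 (-1)\<^sup>m\<close>, used with \<open>m = 10n\<close>;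
  \<^item> Cassini's identity \<open>f\<^bsub>n+1\<^esub> f\<^bsub>n-1\<^esub> = f\<^bsub>n\<^esub>\<^sup>2 + (-1)\<^sup>n\<close> and its Lucas analogue
    \<open>l\<^bsub>m\<^esub> l\<^bsub>m+2\<^esub> = l\<^bsub>m+1\<^esub>\<^sup>2 + 5 (-1)\<^sup>m\<close>, the latter used with \<open>m = 2n\<close>;
  \<^item> \<open>2 f\<^bsub>n\<^esub> f\<^bsub>n+1\<^esub> - f\<^bsub>2n\<^esub> = f\<^bsub>n\<^esub>\<^sup>2 = f\<^bsub>2n\<^esub> - 2 f\<^bsub>n\<^esub> f\<^bsub>n-1\<^esub>\<close>, because \<open>f\<^bsub>2n\<^esub> = f\<^bsub>n\<^esub> (f\<^bsub>n+1\<^esub> + f\<^bsub>n-1\<^esub>)\<close>;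
  \<^item> \<open>5 - 1 = 2\<^sup>2\<close>, while a parameter that is itself a square needs no identity at all.

  All the identities become polynomial in \<open>p = f\<^bsub>n\<^esub>\<close> and \<open>q = f\<^bsub>n+1\<^esub>\<close>: the numbers \<open>f\<^bsub>n-1\<^esub>\<close>, \<open>f\<^bsub>2n\<^esub>\<close>,
  \<open>f\<^bsub>2n+1\<^esub>\<close> and the Lucas numbers are polynomials in \<open>p\<close> and \<open>q\<close>, and the two
  are tied by \<open>q\<^sup>2 - p q - p\<^sup>2 = (-1)\<^sup>n\<close> (\<open>fib_consecutive_relation\<close>).\<close>

lemma split_if_conic_point:
  assumes "a * y\<^sup>2 + b * z\<^sup>2 = x\<^sup>2" "y \<noteq> 0 \<or> z \<noteq> 0"
  shows "split_algebra (HQ a b)"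
  unfolding split_algebra_iff
proof (rule bexI, intro conjI)
  show "Quat x y z 0 \<noteq> \<zero>\<^bsub>HQ a b\<^esub>" using assms(2) by (auto simp: HQ_def)
  show "qnorm (HQ a b) (Quat x y z 0) = 0" using assms(1) by (simp add: HQ_def)
qed (simp add: HQ_def)

lemma split_if_sum_square: "a + b = x\<^sup>2 \<Longrightarrow> split_algebra (HQ a b)"
  by (rule split_if_conic_point[of a 1 b 1 x]) simp_all

lemma split_square_left: "split_algebra (HQ (x\<^sup>2) b)"
  by (rule split_if_conic_point[of _ 1 _ 0 x]) simp_all

lemma split_square_right: "split_algebra (HQ a (x\<^sup>2))"
  by (rule split_if_conic_point[of _ 0 _ 1 x]) simp_all

text \<open>The quadratic form \<open>q\<^sup>2 - p q - p\<^sup>2\<close> changes sign under the Fibonacci step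
  \<open>(p, q) \<mapsto> (q, p + q)\<close>; this is Cassini's identity with \<open>f\<^bsub>n-1\<^esub>\<close> eliminated.\<close>

lemma fib_consecutive_relation:
  "(int (fib (Suc n)))\<^sup>2 - int (fib n) * int (fib (Suc n)) - (int (fib n))\<^sup>2 = (- 1) ^ n"
proof (induction n)
  case (Suc n)
  then show ?case by (simp add: power2_eq_square algebra_simps)
qed simp

lemma fibz_int: "fibz (int n) = int (fib n)"
  by (simp add: fibz_def)

lemma fibz_int_Suc: "fibz (int n + 1) = int (fib (Suc n))"
  using fibz_int[of "Suc n"] by (simp add: add.commute)

text \<open>The recursion \<open>fibz_rec\<close> holds at every integer index, so \<open>n = 0\<close>, where this reads
  \<open>f\<^bsub>-1\<^esub> = 1\<close>, is no exception.\<close>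

lemma fibz_int_pred: "fibz (int n - 1) = int (fib (Suc n)) - int (fib n)"
  using fibz_rec[of "int n + 1"] by (simp add: fibz_int fibz_int_Suc)

lemma fib_odd: "fib (Suc (2 * n)) = (fib n)\<^sup>2 + (fib (Suc n))\<^sup>2"
  using fib_add[of n n] by (simp add: power2_eq_square mult_2)

lemma fib_even: "int (fib (2 * n)) = int (fib n) * (2 * int (fib (Suc n)) - int (fib n))"
proof -
  \<comment> \<open>\<open>fib_add\<close> yields \<open>f\<^bsub>2n+2\<^esub>\<close>, and the odd case takes it down to \<open>f\<^bsub>2n\<^esub>\<close>.\<close>
  have "fib (Suc (Suc (2 * n))) = fib (Suc (Suc n)) * fib (Suc n) + fib (Suc n) * fib n"
    using fib_add[of "Suc n" n] by (simp add: mult_2 mult_2_right algebra_simps)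
  then have "fib (2 * n) + ((fib n)\<^sup>2 + (fib (Suc n))\<^sup>2) =
      fib (Suc (Suc n)) * fib (Suc n) + fib (Suc n) * fib n"
    by (simp add: fib_odd)
  from arg_cong[OF this, of int] show ?thesis
    by (simp add: power2_eq_square algebra_simps)
qed

lemma fibz_double:
  "fibz (2 * int n) = int (fib n) * (2 * int (fib (Suc n)) - int (fib n))"
  using fibz_int[of "2 * n"] by (simp add: fib_even)

lemma fibz_Cassini: "fibz (int n + 1) * fibz (int n - 1) = (fibz (int n))\<^sup>2 + (- 1) ^ n"
  using fib_consecutive_relation[of n] unfolding fibz_int fibz_int_Suc fibz_int_pred
  by (simp add: power2_eq_square algebra_simps)

lemma lucas_fib: "int (lucas n) = 2 * int (fib (Suc n)) - int (fib n)"
  by (induction n rule: lucas.induct) simp_all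

lemma lucas_double: "int (lucas (2 * n)) = 5 * (int (fib n))\<^sup>2 + 2 * (- 1) ^ n"
  using fib_consecutive_relation[of n] unfolding lucas_fib fib_odd fib_even
  by (simp add: power2_eq_square algebra_simps)

text \<open>With \<open>p = f\<^bsub>n\<^esub>\<close> and \<open>q = f\<^bsub>n+1\<^esub>\<close> the three Lucas numbers are \<open>2q - p\<close>, \<open>q + 2p\<close> and \<open>3q + p\<close>,
  and \<open>(2q - p)(3q + p) - (q + 2p)\<^sup>2 = 5 (q\<^sup>2 - p q - p\<^sup>2)\<close>.\<close>

lemma lucas_Cassini:
  "int (lucas n * lucas (n + 2)) = (int (lucas (Suc n)))\<^sup>2 + 5 * (- 1) ^ n"
  using fib_consecutive_relation[of n]
  by (simp add: lucas_fib power2_eq_square algebra_simps)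

theorem proposition3p4:
  fixes n :: nat
  shows
    "split_algebra (HQ (of_int (fibz (10 * int n + 5))) (- 1)) \<and>
     split_algebra (HQ (1 / 5 * of_nat (lucas (20 * n))) (- 2 / 5)) \<and>
     split_algebra (HQ (of_int (fibz (int n + 1) * fibz (int n - 1))) ((- 1) powi (int n - 1))) \<and>
     split_algebra (HQ 5 ((- 1) ^ n)) \<and>
     split_algebra (HQ (of_nat (lucas (2 * n) * lucas (2 * n + 2))) (- 5)) \<and>
     split_algebra (HQ (of_int (2 * fibz (int n) * fibz (int n + 1))) (- of_int (fibz (2 * int n)))) \<and>
     split_algebra (HQ (of_int (fibz (2 * int n))) (- of_int (2 * fibz (int n) * fibz (int n - 1)))) \<and>
     (split_algebra (HQ (of_int (fibz (int n - 1) * fibz (int n + 1))) (of_int ((fibz (int n))\<^sup>2))) \<and>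
      split_algebra (HQ 1 (- of_int (fibz (int n - 1) * fibz (int n + 1))))) \<and>
     split_algebra (HQ (of_int (fibz (2 * int n))) 1)"
proof (intro conjI)
  show "split_algebra (HQ (of_int (fibz (10 * int n + 5))) (- 1))"
  proof (rule split_if_conic_point)
    have "fibz (10 * int n + 5) = int (fib (Suc (2 * (5 * n + 2))))"
      using fibz_int[of "Suc (2 * (5 * n + 2))"] by (simp add: algebra_simps)
    then show "of_int (fibz (10 * int n + 5)) * 1\<^sup>2 + (- 1) * (of_nat (fib (Suc (5 * n + 2))))\<^sup>2
        = (of_nat (fib (5 * n + 2)) :: rat)\<^sup>2"
      unfolding fib_odd by simp
  qed simp
  show "split_algebra (HQ (1 / 5 * of_nat (lucas (20 * n))) (- 2 / 5))"
  proof (rule split_if_sum_square)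
    have "int (lucas (20 * n)) = 5 * (int (fib (10 * n)))\<^sup>2 + 2"
      using lucas_double[of "10 * n"] by simp
    from arg_cong[OF this, of "of_int :: int \<Rightarrow> rat"]
    show "1 / 5 * of_nat (lucas (20 * n)) + (- 2 / 5) = (of_nat (fib (10 * n)) :: rat)\<^sup>2"
      by (simp add: field_simps)
  qed
  show "split_algebra (HQ (of_int (fibz (int n + 1) * fibz (int n - 1))) ((- 1) powi (int n - 1)))"
  proof (rule split_if_sum_square)
    have "(- 1 :: rat) powi (int n - 1) = - ((- 1) ^ n)"
      by (simp add: power_int_diff)
    then show "of_int (fibz (int n + 1) * fibz (int n - 1)) + (- 1) powi (int n - 1)
        = (of_int (fibz (int n)) :: rat)\<^sup>2"
      unfolding fibz_Cassini by simp
  qed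
  show "split_algebra (HQ 5 ((- 1) ^ n))"
  proof (cases "even n")
    case True
    then show ?thesis using split_square_right[of 5 1] by simp
  next
    case False
    then show ?thesis using split_if_sum_square[of 5 "- 1" 2] by simp
  qed
  show "split_algebra (HQ (of_nat (lucas (2 * n) * lucas (2 * n + 2))) (- 5))"
  proof (rule split_if_sum_square)
    have "int (lucas (2 * n) * lucas (2 * n + 2)) = (int (lucas (Suc (2 * n))))\<^sup>2 + 5"
      using lucas_Cassini[of "2 * n"] by simp
    from arg_cong[OF this, of "of_int :: int \<Rightarrow> rat"]
    show "of_nat (lucas (2 * n) * lucas (2 * n + 2)) + (- 5)
        = (of_nat (lucas (Suc (2 * n))) :: rat)\<^sup>2"
      by (simp del: lucas.simps)
  qed
  show "split_algebra (HQ (of_int (2 * fibz (int n) * fibz (int n + 1))) (- of_int (fibz (2 * int n))))"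
    unfolding fibz_double fibz_int fibz_int_Suc
    by (rule split_if_sum_square[where x = "of_nat (fib n)"])
      (simp add: power2_eq_square algebra_simps)
  show "split_algebra (HQ (of_int (fibz (2 * int n))) (- of_int (2 * fibz (int n) * fibz (int n - 1))))"
    unfolding fibz_double fibz_int fibz_int_pred
    by (rule split_if_sum_square[where x = "of_nat (fib n)"])
      (simp add: power2_eq_square algebra_simps)
  show "split_algebra (HQ (of_int (fibz (int n - 1) * fibz (int n + 1))) (of_int ((fibz (int n))\<^sup>2)))"
    using split_square_right[of _ "of_int (fibz (int n))"] by simp
  show "split_algebra (HQ 1 (- of_int (fibz (int n - 1) * fibz (int n + 1))))"
    using split_square_left[of 1] by simp
  show "split_algebra (HQ (of_int (fibz (2 * int n))) 1)"
    using split_square_right[of _ 1] by simp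
qed

end
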